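(* Let $k=4$, $d=1$ (so quantizers are sets of points of $\mathbb{R}$). Let $\sigma>0$, $0<p_{\min}\le\frac1{10}$, and let $N\ge1$ be an integer with $Np_{\min}>\frac18$. Then for any empirically designed quantizer $\hat A_N$ there is a distribution $P\in\mathcal{P}(p_{\min},\sigma)$ such that, if $X_1,\dots,X_N$ are i.i.d. with law $P$ and $\hat A_N=\hat A_N(X_1,\dots,X_N)$, then with probability at least $\frac14$ $$D(\hat A_N,P)-D(A^*,P)\ge\frac{\sigma^2}{60}\sqrt{\frac{1}{Np_{\min}}},$$ where $A^*$ is an optimal quantizer for $P$.
   Context: For a probability measure $P$ on $\mathbb{R}$ and a nonempty finite $A\subset\mathbb{R}$, $D(A,P)=\mathbb{E}_{X\sim P}\min_{a\in A}|X-a|^2$. An optimal quantizer for $P$ is a set $A^*$ with $|A^*|=4$ minimizing $D(A,P)$ over all $A\subset\mathbb{R}$ with $|A|=4$. The elements of every quantizer $A=\{a_1,\dots,a_r\}$ are assumed to be ordered, and its Voronoi cells are $V_{a_j}=\{x: |x-a_j|<|x-a_i|\text{ for }i<j,\ |x-a_j|\le|x-a_i|\text{ for }i>j\}$. The class $\mathcal{P}(p_{\min},\sigma)$ consists of all probability measures $P$ on $\mathbb{R}$ such that $\mathbb{E}_{X\sim P}X^2\le\sigma^2$ and there exists an optimal quantizer $A^*$ (with $4$ points) for $P$ with $\min_{a\in A^*}P(V_a)\ge p_{\min}$. An empirically designed quantizer $\hat A_N$ is a (measurable) map assigning to each sample in $\mathbb{R}^N$ a nonempty set of at most $4$ points of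 $\mathbb{R}$; it does not depend on $P$. The probability is with respect to $P^{\otimes N}$. *)

theory Defs
  imports "HOL-Probability.Probability"
begin

text \<open>
  Probability measures on the real line are measures satisfying \<^const>\<open>real_distribution\<close>, i.e.
  probability spaces on the Borel sigma-algebra. The Bochner integral below is the expectation
  whenever \<open>P\<close> has a finite second moment; this is part of \<open>quantizer_class\<close>.
\<close>

definition distortion :: "real set \<Rightarrow> real measure \<Rightarrow> real" where
  "distortion A P = (LINT x|P. Min ((\<lambda>a. \<bar>x - a\<bar> ^ 2) ` A))"

definition optimal_quantizer :: "nat \<Rightarrow> real measure \<Rightarrow> real set \<Rightarrow> bool" where
  "optimal_quantizer k P A \<longleftrightarrow>
     finite A \<and> card A = k \<and>
     (\<forall>B. finite B \<and> card B = k \<longrightarrow> distortion A P \<le> distortion B P)"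

text \<open>
  The points of a quantizer are ordered increasingly, so a point equidistant from two nearest
  points of \<open>A\<close> belongs to the cell of the smaller one.
\<close>

definition voronoi_cell :: "real set \<Rightarrow> real \<Rightarrow> real set" where
  "voronoi_cell A a =
     {x. (\<forall>b\<in>A. b < a \<longrightarrow> \<bar>x - a\<bar> < \<bar>x - b\<bar>) \<and> (\<forall>b\<in>A. a < b \<longrightarrow> \<bar>x - a\<bar> \<le> \<bar>x - b\<bar>)}"

definition quantizer_class :: "nat \<Rightarrow> real \<Rightarrow> real \<Rightarrow> real measure set" where
  "quantizer_class k p_min \<sigma> =
     {P. real_distribution P \<and>
         integrable P (\<lambda>x. x ^ 2) \<and> (LINT x|P. x ^ 2) \<le> \<sigma> ^ 2 \<and>
         (\<exists>A. optimal_quantizer k P A \<and>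
              Min ((\<lambda>a. measure P (voronoi_cell A a)) ` A) \<ge> p_min)}"

text \<open>
  Measurability of the set-valued map is in the sense of Effros: hitting an open set is a
  measurable event. For finite sets of at most \<open>k\<close> points this is Borel measurability with respect
  to the Hausdorff metric, or equivalently the existence of a measurable enumeration
  \<open>{a\<^sub>1(x), \<dots>, a\<^sub>k(x)}\<close>, repetitions allowed.
\<close>

definition empirical_quantizer ::
    "nat \<Rightarrow> nat \<Rightarrow> ((nat \<Rightarrow> real) \<Rightarrow> real set) \<Rightarrow> bool" where
  "empirical_quantizer k N Q \<longleftrightarrow>
     (\<forall>x \<in> space (Pi\<^sub>M {..<N} (\<lambda>_. borel)). Q x \<noteq> {} \<and> finite (Q x) \<and> card (Q x) \<le> k) \<and>
     (\<forall>U. open U \<longrightarrow> {x \<in> space (Pi\<^sub>M {..<N} (\<lambda>_. borel)). Q x \<inter> U \<noteq> {}}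
                       \<in> sets (Pi\<^sub>M {..<N} (\<lambda>_. borel :: real measure)))"

end

theory Submission
  imports Defs
begin

text \<open>
  Take five atoms: a heavy one at the origin and two symmetric outer pairs, whose atoms have mass
  \<open>p * (1 - \<delta>)\<close> on the left and \<open>p * (1 + \<delta>)\<close> on the right, or vice versa. By the pigeonhole
  principle four code points must serve two of the atoms with the same point, and it is optimal to
  merge the lighter pair. A quantizer that is good for one of the two distributions is therefore bad
  for the other, the loss being proportional to \<open>\<delta> * \<sigma>\<^sup>2\<close>. For \<open>\<delta>\<close> of order \<open>1 / sqrt (N * p)\<close> the
  two distributions cannot be told apart from \<open>N\<close> samples: with respect to the product of the
  unperturbed law (\<open>\<delta> = 0\<close>) the densities of the two sample laws are close in \<open>L\<^sup>2\<close>.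
\<close>

section \<open>Measures with finitely many atoms\<close>

text \<open>Atoms are indexed, so coinciding points \<open>x i\<close> add up their masses and
  integrals are sums over indices. \<open>ennreal\<close> sends negative masses to 0, whence the
  assumptions \<open>0 \<le> m i\<close> below.\<close>

definition atomic_measure :: "nat \<Rightarrow> (nat \<Rightarrow> real) \<Rightarrow> (nat \<Rightarrow> real) \<Rightarrow> real measure" where
  "atomic_measure n m x = distr (point_measure {..<n} (\<lambda>i. ennreal (m i))) borel x"

lemma sets_atomic_measure [simp, measurable_cong]: "sets (atomic_measure n m x) = sets borel"
  by (simp add: atomic_measure_def)

lemma space_atomic_measure [simp]: "space (atomic_measure n m x) = UNIV"
  by (simp add: atomic_measure_def)

lemma measurable_point_measure_borel:
  "x \<in> point_measure A f \<rightarrow>\<^sub>M borel"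
  by (simp add: measurable_def space_point_measure sets_point_measure)

lemma integral_atomic_measure:
  fixes f :: "real \<Rightarrow> real"
  assumes "\<And>i. i < n \<Longrightarrow> 0 \<le> m i" and "f \<in> borel_measurable borel"
  shows "(LINT y|atomic_measure n m x. f y) = (\<Sum>i<n. m i * f (x i))"
  unfolding atomic_measure_def using assms
  by (simp add: integral_distr measurable_point_measure_borel,
      subst lebesgue_integral_point_measure_finite) auto

lemma integrable_atomic_measure:
  fixes f :: "real \<Rightarrow> real"
  assumes "f \<in> borel_measurable borel"
  shows "integrable (atomic_measure n m x) f"
  unfolding atomic_measure_def using assms
  by (subst integrable_distr_eq)
    (auto simp: measurable_point_measure_borel intro!: integrable_point_measure_finite)

lemma emeasure_atomic_measure_UNIV:
  assumes "\<And>i. i < n \<Longrightarrow> 0 \<le> m i" and "(\<Sum>i<n. m i) = 1"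
  shows "emeasure (atomic_measure n m x) UNIV = 1"
proof -
  have "(\<Sum>i<n. ennreal (m i)) = 1"
    using assms by (subst sum_ennreal) auto
  then show ?thesis
    unfolding atomic_measure_def
    by (subst emeasure_distr)
      (auto simp: measurable_point_measure_borel space_point_measure emeasure_point_measure_finite)
qed

lemma real_distribution_atomic_measure:
  assumes "\<And>i. i < n \<Longrightarrow> 0 \<le> m i" and "(\<Sum>i<n. m i) = 1"
  shows "real_distribution (atomic_measure n m x)"
  using emeasure_atomic_measure_UNIV[OF assms]
  by (auto simp: real_distribution_def real_distribution_axioms_def intro!: prob_spaceI)

lemma measure_atomic_measure:
  assumes "\<And>i. i < n \<Longrightarrow> 0 \<le> m i" and "(\<Sum>i<n. m i) = 1" and "B \<in> sets borel"
  shows "measure (atomic_measure n m x) B = (\<Sum>i<n. m i * indicator B (x i))"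
proof -
  have "measure (atomic_measure n m x) B = (LINT y|atomic_measure n m x. indicator B y)"
    using assms(3) by simp
  then show ?thesis
    using assms by (simp only: integral_atomic_measure borel_measurable_indicator)
qed

text \<open>Turns perturbed laws on fixed atoms into densities over one reference law.\<close>

lemma density_atomic_measure:
  assumes "\<And>i. i < n \<Longrightarrow> 0 \<le> m i" and "g \<in> borel_measurable borel" and "\<And>y. 0 \<le> g y"
  shows "density (atomic_measure n m x) (\<lambda>y. ennreal (g y)) =
    atomic_measure n (\<lambda>i. m i * g (x i)) x"
proof -
  have "point_measure {..<n} (\<lambda>i. ennreal (m i) * ennreal (g (x i))) =
    point_measure {..<n} (\<lambda>i. ennreal (m i * g (x i)))"
    using assms unfolding point_measure_def by (intro density_cong)
      (auto simp: ennreal_mult AE_count_space)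
  then show ?thesis
    unfolding atomic_measure_def using assms
    by (subst density_distr)
      (auto simp: measurable_point_measure_borel point_measure_def density_density_eq ennreal_mult)
qed

lemma borel_measurable_Min_sqdist:
  assumes "finite B"
  shows "(\<lambda>y. Min ((\<lambda>a. \<bar>y - a\<bar> ^ 2) ` B)) \<in> borel_measurable (borel :: real measure)"
  using assms by (intro borel_measurable_Min) auto

lemma distortion_atomic_measure:
  assumes "\<And>i. i < n \<Longrightarrow> 0 \<le> m i" and "finite B"
  shows "distortion B (atomic_measure n m x) =
    (\<Sum>i<n. m i * Min ((\<lambda>a. \<bar>x i - a\<bar> ^ 2) ` B))"
  unfolding distortion_def using assms
  by (intro integral_atomic_measure borel_measurable_Min_sqdist) auto

section \<open>The cost of sharing a code point\<close>

text \<open>The minimizing \<open>b\<close> is the weighted mean of \<open>u\<close> and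
  \<open>v\<close>; the excess over the minimum, times \<open>\<mu> + \<nu>\<close>, is a
  square.\<close>

lemma weighted_sqdist_ge:
  fixes \<mu> \<nu> :: real
  assumes "0 < \<mu>" "0 < \<nu>"
  shows "\<mu> * \<nu> / (\<mu> + \<nu>) * (u - v) ^ 2 \<le> \<mu> * (u - b) ^ 2 + \<nu> * (v - b) ^ 2"
proof -
  have "(\<mu> + \<nu>) * (\<mu> * (u - b) ^ 2 + \<nu> * (v - b) ^ 2) - \<mu> * \<nu> * (u - v) ^ 2
      = (\<mu> * (u - b) + \<nu> * (v - b)) ^ 2"
    by algebra
  then have "\<mu> * \<nu> * (u - v) ^ 2 \<le> (\<mu> + \<nu>) * (\<mu> * (u - b) ^ 2 + \<nu> * (v - b) ^ 2)"
    by (smt (verit) zero_le_power2)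
  then show ?thesis
    using assms by (simp add: pos_divide_le_eq mult.commute)
qed

text \<open>Two of the \<open>n\<close> atoms share a nearest code point. The pair is found from
  positions alone and so precedes the quantifier over the masses \<open>m\<close>: one pair serves
  all perturbations at once.\<close>

lemma merging_cost_le_distortion:
  fixes x :: "nat \<Rightarrow> real"
  assumes "finite B" "B \<noteq> {}" "card B < n"
  shows "\<exists>i j. i < j \<and> j < n \<and> (\<forall>m. (\<forall>k<n. 0 < m k) \<longrightarrow>
    m i * m j / (m i + m j) * (x i - x j) ^ 2 \<le> distortion B (atomic_measure n m x))"
proof -
  define d where "d y = Min ((\<lambda>a. \<bar>y - a\<bar> ^ 2) ` B)" for y :: real
  have "\<exists>a\<in>B. d y = (y - a) ^ 2" for y
  proof -
    have "d y \<in> (\<lambda>a. \<bar>y - a\<bar> ^ 2) ` B"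
      unfolding d_def using assms by (intro Min_in) auto
    then show ?thesis by auto
  qed
  then obtain f where f: "\<And>y. f y \<in> B" "\<And>y. d y = (y - f y) ^ 2"
    by metis
  have "card ((\<lambda>i. f (x i)) ` {..<n}) \<le> card B"
    using assms(1) f(1) by (intro card_mono) auto
  then have "\<not> inj_on (\<lambda>i. f (x i)) {..<n}"
    using assms(3) by (intro pigeonhole) simp
  then obtain i j where ij: "i < j" "j < n" "f (x i) = f (x j)"
    unfolding inj_on_def by (metis lessThan_iff linorder_neqE_nat)
  have "m i * m j / (m i + m j) * (x i - x j) ^ 2 \<le> distortion B (atomic_measure n m x)"
    if m: "\<forall>k<n. 0 < m k" for m
  proof -
    have "m i * m j / (m i + m j) * (x i - x j) ^ 2 \<le> m i * d (x i) + m j * d (x j)"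
      using weighted_sqdist_ge[of "m i" "m j" "x i" "x j" "f (x j)"] m ij f(2) by simp
    also have "\<dots> = (\<Sum>k\<in>{i, j}. m k * d (x k))"
      using ij by simp
    also have "\<dots> \<le> (\<Sum>k<n. m k * d (x k))"
      using ij m f(2) by (intro sum_mono2) (auto intro!: mult_nonneg_nonneg simp: less_imp_le)
    also have "\<dots> = distortion B (atomic_measure n m x)"
      using m assms(1) by (subst distortion_atomic_measure) (auto simp: d_def less_imp_le)
    finally show ?thesis .
  qed
  with ij show ?thesis by blast
qed

section \<open>Product densities and two-point testing\<close>

text \<open>A product measure is determined on boxes, where the integral of the product density
  factorises by Fubini.\<close>

lemma density_PiM:
  assumes "finite I" and "prob_space M" and "prob_space (density M f)"
    and [measurable]: "f \<in> borel_measurable M"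
  shows "PiM I (\<lambda>_. density M f) = density (PiM I (\<lambda>_. M)) (\<lambda>x. \<Prod>i\<in>I. f (x i))"
proof -
  interpret M: prob_space M by fact
  interpret D: prob_space "density M f" by fact
  interpret PM: product_sigma_finite "\<lambda>_. M" ..
  interpret PD: product_sigma_finite "\<lambda>_. density M f" ..
  show ?thesis
  proof (rule PD.PiM_eqI[symmetric])
    show "finite I" by fact
    show "sets (density (PiM I (\<lambda>_. M)) (\<lambda>x. \<Prod>i\<in>I. f (x i))) = sets (PiM I (\<lambda>_. density M f))"
      by (simp cong: sets_PiM_cong)
  next
    fix A assume "\<And>i. i \<in> I \<Longrightarrow> A i \<in> sets (density M f)"
    then have A: "\<And>i. i \<in> I \<Longrightarrow> A i \<in> sets M" by simp
    have meas: "PiE I A \<in> sets (PiM I (\<lambda>_. M))"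
      using A assms(1) by (intro sets_PiM_I_finite) auto
    have "emeasure (density (PiM I (\<lambda>_. M)) (\<lambda>x. \<Prod>i\<in>I. f (x i))) (PiE I A)
      = (\<integral>\<^sup>+ x. (\<Prod>i\<in>I. f (x i)) * indicator (PiE I A) x \<partial>PiM I (\<lambda>_. M))"
      using meas by (intro emeasure_density) auto
    also have "\<dots> = (\<integral>\<^sup>+ x. (\<Prod>i\<in>I. f (x i) * indicator (A i) (x i)) \<partial>PiM I (\<lambda>_. M))"
    proof (rule nn_integral_cong)
      fix x assume "x \<in> space (PiM I (\<lambda>_. M))"
      then have "x \<in> extensional I" by (simp add: space_PiM PiE_iff)
      then have "indicator (PiE I A) x = (\<Prod>i\<in>I. indicator (A i) (x i) :: ennreal)"
        using assms(1) by (auto simp: indicator_def PiE_iff intro: prod.neutral[symmetric])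
      then show "(\<Prod>i\<in>I. f (x i)) * indicator (PiE I A) x
        = (\<Prod>i\<in>I. f (x i) * indicator (A i) (x i))"
        by (simp add: prod.distrib)
    qed
    also have "\<dots> = (\<Prod>i\<in>I. \<integral>\<^sup>+ y. f y * indicator (A i) y \<partial>M)"
      using A assms(1) by (intro PM.product_nn_integral_prod) auto
    also have "\<dots> = (\<Prod>i\<in>I. emeasure (density M f) (A i))"
      using A by (intro prod.cong) (auto simp: emeasure_density)
    finally show "emeasure (density (PiM I (\<lambda>_. M)) (\<lambda>x. \<Prod>i\<in>I. f (x i))) (PiE I A)
      = (\<Prod>i\<in>I. emeasure (density M f) (A i))" .
  qed
qed

text \<open>
  The \<open>L\<^sup>2\<close> form of Le Cam's two-point bound. It rests on
  \<open>\<bar>u\<bar> / 2 \<le> u\<^sup>2 / 4 + 1 / 4\<close>, applied to \<open>u = G - F\<close> multiplied by \<open>1\<^sub>B - 1 / 2\<close>.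
\<close>

lemma (in prob_space) two_point_testing:
  fixes F G :: "'a \<Rightarrow> real"
  assumes F: "integrable M F" "\<And>x. 0 \<le> F x" "expectation F = 1"
    and G: "integrable M G" "\<And>x. 0 \<le> G x" "expectation G = 1"
    and sq: "integrable M (\<lambda>x. (G x - F x) ^ 2)" "expectation (\<lambda>x. (G x - F x) ^ 2) \<le> 1"
    and B: "B \<in> events"
  shows "1 / 2 \<le> measure (density M (\<lambda>x. ennreal (F x))) B
    + measure (density M (\<lambda>x. ennreal (G x))) (space M - B)"
proof -
  have meas: "measure (density M (\<lambda>x. ennreal (H x))) A = expectation (\<lambda>x. H x * indicator A x)"
    if "integrable M H" "\<And>x. 0 \<le> H x" "A \<in> events" for H :: "'a \<Rightarrow> real" and A
  proof -
    have "measure (density M (\<lambda>x. ennreal (H x))) A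
        = (LINT x|density M (\<lambda>x. ennreal (H x)). indicator A x)"
      using that by simp
    also have "\<dots> = expectation (\<lambda>x. H x * indicator A x)"
      using that by (subst integral_real_density) auto
    finally show ?thesis .
  qed
  have int: "integrable M (\<lambda>x. F x * indicator B x)"
    "integrable M (\<lambda>x. G x * indicator (space M - B) x)"
    using F G B by (auto intro: integrable_real_mult_indicator)
  have "1 - 1 / 4 * (1 + 1) \<le> (1 + 1) / 2 - 1 / 4 * (expectation (\<lambda>x. (G x - F x) ^ 2) + 1)"
    using sq(2) by simp
  also have "\<dots> = expectation (\<lambda>x. (F x + G x) / 2 - 1 / 4 * ((G x - F x) ^ 2 + 1))"
    using F G sq(1) by (simp add: prob_space)
  also have "\<dots> \<le> expectation (\<lambda>x. F x * indicator B x + G x * indicator (space M - B) x)"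
  proof (rule integral_mono)
    fix x assume x: "x \<in> space M"
    \<comment> \<open>The second square gives the bound on \<open>B\<close>, the first one off
      \<open>B\<close>.\<close>
    have "0 \<le> (G x - F x + 1) ^ 2" "0 \<le> (G x - F x - 1) ^ 2"
      by simp_all
    then show "(F x + G x) / 2 - 1 / 4 * ((G x - F x) ^ 2 + 1)
        \<le> F x * indicator B x + G x * indicator (space M - B) x"
      using x by (cases "x \<in> B") (auto simp: power2_eq_square field_simps)
  qed (use F G sq(1) int in auto)
  also have "\<dots> = measure (density M (\<lambda>x. ennreal (F x))) B
    + measure (density M (\<lambda>x. ennreal (G x))) (space M - B)"
    using meas F G B int by simp
  finally show ?thesis by simp
qed

text \<open>The minimal squared distance from \<open>y\<close> is below \<open>t\<close> exactly
  when \<open>Q s\<close> hits the open set of points at squared distance below \<open>t\<close>,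
  which is the event that Effros measurability covers.\<close>

lemma borel_measurable_distortion_empirical:
  assumes Q: "empirical_quantizer k N Q" and m: "\<And>i. i < n \<Longrightarrow> 0 \<le> m i"
  shows "(\<lambda>s. distortion (Q s) (atomic_measure n m x))
    \<in> borel_measurable (PiM {..<N} (\<lambda>_. borel))"
proof -
  let ?S = "PiM {..<N} (\<lambda>_. borel :: real measure)"
  have fin: "finite (Q s)" "Q s \<noteq> {}" if "s \<in> space ?S" for s
    using Q that by (auto simp: empirical_quantizer_def)
  have [measurable]: "(\<lambda>s. Min ((\<lambda>a. \<bar>y - a\<bar> ^ 2) ` Q s)) \<in> borel_measurable ?S" for y :: real
  proof (rule borel_measurableI_less)
    fix t :: real
    have "open {a. \<bar>y - a\<bar> ^ 2 < t}"
      by (intro open_Collect_less continuous_intros)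
    then have "{s \<in> space ?S. Q s \<inter> {a. \<bar>y - a\<bar> ^ 2 < t} \<noteq> {}} \<in> sets ?S"
      using Q by (simp add: empirical_quantizer_def)
    also have "{s \<in> space ?S. Q s \<inter> {a. \<bar>y - a\<bar> ^ 2 < t} \<noteq> {}}
      = {s \<in> space ?S. Min ((\<lambda>a. \<bar>y - a\<bar> ^ 2) ` Q s) < t}"
      using fin by (auto simp: Min_less_iff)
    finally show "{s \<in> space ?S. Min ((\<lambda>a. \<bar>y - a\<bar> ^ 2) ` Q s) < t} \<in> sets ?S" .
  qed
  have "(\<lambda>s. \<Sum>i<n. m i * Min ((\<lambda>a. \<bar>x i - a\<bar> ^ 2) ` Q s)) \<in> borel_measurable ?S"
    by measurable
  then show ?thesis
    using fin m by (subst measurable_cong) (auto simp: distortion_atomic_measure)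
qed

text \<open>By independence, the squared \<open>L\<^sup>2\<close> distance of the two product
  densities is the left side of \<open>le\<close>: each of its three terms is a power of a
  one-coordinate moment.\<close>

lemma prob_space_product_testing:
  fixes f g :: "'a \<Rightarrow> real"
  assumes "finite I" and M: "prob_space M"
    and f [measurable]: "f \<in> borel_measurable M" and f': "\<And>x. 0 \<le> f x" "integral\<^sup>L M f = 1"
    and g [measurable]: "g \<in> borel_measurable M" and g': "\<And>x. 0 \<le> g x" "integral\<^sup>L M g = 1"
    and ff: "integrable M (\<lambda>x. f x ^ 2)" and gg: "integrable M (\<lambda>x. g x ^ 2)"
    and fg: "integrable M (\<lambda>x. f x * g x)"
    and le: "(LINT x|M. f x ^ 2) ^ card I + (LINT x|M. g x ^ 2) ^ card I
      - 2 * (LINT x|M. f x * g x) ^ card I \<le> 1"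
    and B: "B \<in> sets (PiM I (\<lambda>_. M))"
  shows "1 / 2 \<le> measure (PiM I (\<lambda>_. density M (\<lambda>x. ennreal (f x)))) B
    + measure (PiM I (\<lambda>_. density M (\<lambda>x. ennreal (g x)))) (space (PiM I (\<lambda>_. M)) - B)"
proof -
  interpret M: prob_space M by fact
  interpret P: product_prob_space "\<lambda>_. M" I ..
  \<comment> \<open>A non-integrable function would have Bochner integral 0 instead of 1.\<close>
  have intf: "integrable M f" and intg: "integrable M g"
    using f'(2) g'(2) not_integrable_integral_eq[of M f] not_integrable_integral_eq[of M g] by auto
  define F where "F x = (\<Prod>i\<in>I. f (x i))" for x
  define G where "G x = (\<Prod>i\<in>I. g (x i))" for x
  have dens: "PiM I (\<lambda>_. density M (\<lambda>x. ennreal (h x)))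
      = density (PiM I (\<lambda>_. M)) (\<lambda>x. ennreal (\<Prod>i\<in>I. h (x i)))"
    if h: "integrable M h" "\<And>x. 0 \<le> h x" "integral\<^sup>L M h = 1" for h :: "'a \<Rightarrow> real"
  proof -
    have [measurable]: "h \<in> borel_measurable M"
      using h(1) by simp
    have "(\<integral>\<^sup>+ x. ennreal (h x) \<partial>M) = 1"
      using h by (simp add: nn_integral_eq_integral)
    then have "prob_space (density M (\<lambda>x. ennreal (h x)))"
      by (intro prob_spaceI) (simp add: emeasure_density cong: nn_integral_cong)
    then show ?thesis
      using density_PiM[OF assms(1) M, of "\<lambda>x. ennreal (h x)"] h by (simp add: prod_ennreal)
  qed
  have prodI: "integrable (PiM I (\<lambda>_. M)) (\<lambda>x. \<Prod>i\<in>I. h (x i))"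
    "(LINT x|PiM I (\<lambda>_. M). (\<Prod>i\<in>I. h (x i))) = integral\<^sup>L M h ^ card I"
    if "integrable M h" for h :: "'a \<Rightarrow> real"
    using P.product_integrable_prod[of I "\<lambda>_. h"] P.product_integral_prod[of I "\<lambda>_. h"] assms(1) that
    by auto
  have sq: "(G x - F x) ^ 2 = (\<Prod>i\<in>I. g (x i) ^ 2) + (\<Prod>i\<in>I. f (x i) ^ 2)
      - 2 * (\<Prod>i\<in>I. f (x i) * g (x i))" for x
    by (simp add: F_def G_def power2_diff prod.distrib prod_power_distrib)
  have "1 / 2 \<le> measure (density (PiM I (\<lambda>_. M)) (\<lambda>x. ennreal (F x))) B
    + measure (density (PiM I (\<lambda>_. M)) (\<lambda>x. ennreal (G x))) (space (PiM I (\<lambda>_. M)) - B)"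
  proof (rule P.two_point_testing)
    show "P.expectation (\<lambda>x. (G x - F x) ^ 2) \<le> 1"
      unfolding sq using le prodI[OF ff] prodI[OF gg] prodI[OF fg] by simp
    show "integrable (PiM I (\<lambda>_. M)) (\<lambda>x. (G x - F x) ^ 2)"
      unfolding sq using prodI[OF ff] prodI[OF gg] prodI[OF fg] by simp
  qed (use prodI[OF intf] prodI[OF intg] f' g' B in \<open>auto simp: F_def G_def intro!: prod_nonneg\<close>)
  then show ?thesis
    unfolding dens[OF intf f'] dens[OF intg g'] F_def G_def .
qed

section \<open>Upper bounds on distortion; Voronoi cells\<close>

text \<open>Any assignment \<open>f\<close> of atoms to code points costs at least as much as the
  nearest one.\<close>

lemma distortion_atomic_measure_le:
  assumes "\<And>i. i < n \<Longrightarrow> 0 \<le> m i" and "finite A" and "\<And>i. i < n \<Longrightarrow> f i \<in> A"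
  shows "distortion A (atomic_measure n m x) \<le> (\<Sum>i<n. m i * (x i - f i) ^ 2)"
proof -
  have "distortion A (atomic_measure n m x) = (\<Sum>i<n. m i * Min ((\<lambda>a. \<bar>x i - a\<bar> ^ 2) ` A))"
    using assms by (intro distortion_atomic_measure) auto
  also have "\<dots> \<le> (\<Sum>i<n. m i * \<bar>x i - f i\<bar> ^ 2)"
    using assms by (intro sum_mono mult_left_mono Min_le) auto
  finally show ?thesis by simp
qed

lemma borel_voronoi_cell:
  assumes "finite A"
  shows "voronoi_cell A a \<in> sets borel"
proof -
  have "voronoi_cell A a = {x \<in> space borel. (\<forall>b\<in>A. b < a \<longrightarrow> \<bar>x - a\<bar> < \<bar>x - b\<bar>)
    \<and> (\<forall>b\<in>A. a < b \<longrightarrow> \<bar>x - a\<bar> \<le> \<bar>x - b\<bar>)}"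
    by (simp add: voronoi_cell_def)
  also have "\<dots> \<in> sets borel"
    using countable_finite[OF assms] by measurable
  finally show ?thesis .
qed

text \<open>Reduces the cells to scale 1, where they are decided numerically.\<close>

lemma voronoi_cell_scale:
  assumes "0 < c"
  shows "c * x \<in> voronoi_cell ((*) c ` A) (c * a) \<longleftrightarrow> x \<in> voronoi_cell A a"
  using assms unfolding voronoi_cell_def
  by (simp add: right_diff_distrib[symmetric] abs_mult)

section \<open>The five-atom family\<close>

text \<open>
  The atoms are \<open>c * offset i\<close>. The ratio 4 : 5 of the distance to the origin and the width of an
  outer pair makes merging an outer atom with its partner no dearer than merging it with any other
  atom.
\<close>

definition offset :: "nat \<Rightarrow> real" where
  "offset i = [-9, -4, 0, 4, 9] ! i"

text \<open>The tilt factor depends on an atom only through its sign, so it is the value there of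
  the density \<open>1 + \<delta> * sgn y\<close>. The origin keeps its mass because
  \<open>sgn 0 = 0\<close>.\<close>

definition mass :: "real \<Rightarrow> real \<Rightarrow> nat \<Rightarrow> real" where
  "mass p \<delta> i = (if i = 2 then 1 - 4 * p else p) * (1 + \<delta> * sgn (offset i))"

definition hard_measure :: "real \<Rightarrow> real \<Rightarrow> real \<Rightarrow> real measure" where
  "hard_measure p c \<delta> = atomic_measure 5 (mass p \<delta>) (\<lambda>i. c * offset i)"

lemma offset_simps:
  "offset 0 = -9" "offset (Suc 0) = -4" "offset 2 = 0" "offset 3 = 4" "offset 4 = 9"
  by (simp_all add: offset_def)

lemma mass_simps:
  "mass p \<delta> 0 = p * (1 - \<delta>)" "mass p \<delta> (Suc 0) = p * (1 - \<delta>)" "mass p \<delta> 2 = 1 - 4 * p"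
  "mass p \<delta> 3 = p * (1 + \<delta>)" "mass p \<delta> 4 = p * (1 + \<delta>)"
  by (simp_all add: mass_def offset_simps)

lemma all_less_5: "(\<forall>i<5. P i) \<longleftrightarrow> P 0 \<and> P (Suc 0) \<and> P 2 \<and> P 3 \<and> P (4::nat)"
  by (simp add: All_less_Suc numeral_eq_Suc conj_commute conj_left_commute)

lemma sum_less_5: "(\<Sum>i<5. f i) = f 0 + f (Suc 0) + f 2 + f 3 + f (4::nat)"
  for f :: "nat \<Rightarrow> real"
  by (simp add: numeral_eq_Suc)

lemma mass_pos:
  assumes "0 < p" "p \<le> 1 / 10" "\<bar>\<delta>\<bar> \<le> 1 / 2"
  shows "\<forall>i<5. 0 < mass p \<delta> i"
  using assms by (simp add: all_less_5 mass_simps)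

lemma sum_mass: "(\<Sum>i<5. mass p \<delta> i) = 1"
  by (simp add: sum_less_5 mass_simps algebra_simps)

text \<open>Clears the denominator of a merging cost, leaving a condition linear in the masses. Two
  orders are given since the outer atom, of mass \<open>\<mu>\<close>, may come first or second in
  its pair.\<close>

lemma merging_cost_ge:
  fixes \<mu> \<nu> :: real
  assumes "0 < \<mu>" "0 < \<nu>" "r * (\<mu> + \<nu>) \<le> \<nu> * s"
  shows "r * \<mu> \<le> \<mu> * \<nu> / (\<mu> + \<nu>) * s" "r * \<mu> \<le> \<nu> * \<mu> / (\<nu> + \<mu>) * s"
proof -
  have "r * \<mu> * (\<mu> + \<nu>) \<le> \<mu> * \<nu> * s"
    using mult_left_mono[OF assms(3), of \<mu>] assms(1) by (simp add: algebra_simps)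
  then show "r * \<mu> \<le> \<mu> * \<nu> / (\<mu> + \<nu>) * s"
    using assms by (simp add: pos_le_divide_eq)
  then show "r * \<mu> \<le> \<nu> * \<mu> / (\<nu> + \<mu>) * s"
    by (simp add: mult.commute add.commute)
qed

section \<open>Optimal quantizers of the five-atom measures\<close>

text \<open>The shared pair contains a left atom or else a right one. This side is decided by
  \<open>B\<close> alone, so the disjunction stands outside the quantifiers over
  \<open>\<delta>\<close>. The factor \<open>25 / 2\<close> is the cost of merging two unit masses
  at distance 5.\<close>

lemma hard_measure_distortion_ge:
  assumes p: "0 < p" "p \<le> 1 / 10" and B: "finite B" "B \<noteq> {}" "card B \<le> 4"
  shows "(\<forall>\<delta>. \<bar>\<delta>\<bar> \<le> 1 / 2 \<longrightarrow> 25 / 2 * (p * (1 - \<delta>)) * c\<^sup>2 \<le> distortion B (hard_measure p c \<delta>)) \<or>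
    (\<forall>\<delta>. \<bar>\<delta>\<bar> \<le> 1 / 2 \<longrightarrow> 25 / 2 * (p * (1 + \<delta>)) * c\<^sup>2 \<le> distortion B (hard_measure p c \<delta>))"
proof -
  obtain i j where ij: "i < j" "j < 5" and
    le: "\<And>m. (\<forall>k<5. 0 < m k) \<Longrightarrow> m i * m j / (m i + m j) * (c * offset i - c * offset j) ^ 2
      \<le> distortion B (atomic_measure 5 m (\<lambda>i. c * offset i))"
    using merging_cost_le_distortion[OF B(1,2), of 5 "\<lambda>i. c * offset i"] B(3) by auto
  have D: "mass p \<delta> i * mass p \<delta> j / (mass p \<delta> i + mass p \<delta> j) * (offset i - offset j)\<^sup>2 * c\<^sup>2
      \<le> distortion B (hard_measure p c \<delta>)" if "\<bar>\<delta>\<bar> \<le> 1 / 2" for \<delta>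
    using le[OF mass_pos[OF p that]]
    by (simp add: hard_measure_def right_diff_distrib[symmetric] power_mult_distrib mult_ac)
  have d: "p * \<delta> \<le> p / 2" "- (p / 2) \<le> p * \<delta>" if "\<bar>\<delta>\<bar> \<le> 1 / 2" for \<delta>
    using mult_left_mono[of \<delta> "1 / 2" p] mult_left_mono[of "- 1 / 2" \<delta> p] p that by auto
  have "(\<forall>\<delta>. \<bar>\<delta>\<bar> \<le> 1 / 2 \<longrightarrow> 25 / 2 * (p * (1 - \<delta>))
        \<le> mass p \<delta> i * mass p \<delta> j / (mass p \<delta> i + mass p \<delta> j) * (offset i - offset j)\<^sup>2) \<or>
      (\<forall>\<delta>. \<bar>\<delta>\<bar> \<le> 1 / 2 \<longrightarrow> 25 / 2 * (p * (1 + \<delta>))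
        \<le> mass p \<delta> i * mass p \<delta> j / (mass p \<delta> i + mass p \<delta> j) * (offset i - offset j)\<^sup>2)"
    (is "(\<forall>\<delta>. _ \<longrightarrow> ?L \<delta>) \<or> (\<forall>\<delta>. _ \<longrightarrow> ?R \<delta>)")
  proof (cases "i \<le> 1")
    case True
    have "?L \<delta>" if \<delta>: "\<bar>\<delta>\<bar> \<le> 1 / 2" for \<delta>
    proof -
      \<comment> \<open>With \<open>p * \<delta>\<close> as a single unknown, bounded by
        \<open>p / 2\<close> in absolute value, every case is linear in \<open>p\<close> and
        \<open>e\<close>.\<close>
      define e where "e = p * \<delta>"
      have pos: "0 < mass p \<delta> i" "0 < mass p \<delta> j"
        using mass_pos[OF p \<delta>] ij by auto
      consider "i = 0" "j = 1" | "i = 0" "j = 2" | "i = 0" "j = 3" | "i = 0" "j = 4"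
        | "i = 1" "j = 2" | "i = 1" "j = 3" | "i = 1" "j = 4"
        using True ij by (auto simp: le_Suc_eq less_Suc_eq numeral_eq_Suc)
      \<comment> \<open>The pair 0, 1 gives equality. Merging -4 with the origin is delicate: it
        needs \<open>25 / 2 * (3 / 2 * p) \<le> 7 / 2 * (1 - 4 * p)\<close> in the worst tilt, true
        for \<open>p \<le> 1 / 10\<close>.\<close>
      then have key: "25 / 2 * (mass p \<delta> i + mass p \<delta> j) \<le> mass p \<delta> j * (offset i - offset j)\<^sup>2"
        using p d[OF \<delta>, folded e_def]
        by cases (simp_all add: offset_simps mass_simps right_diff_distrib distrib_left flip: e_def)
      have "mass p \<delta> i = p * (1 - \<delta>)"
        using True by (cases i) (auto simp: mass_simps)
      then show ?thesis
        using merging_cost_ge(1)[OF pos key] by (simp only:)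
    qed
    then show ?thesis by blast
  next
    case False
    have "?R \<delta>" if \<delta>: "\<bar>\<delta>\<bar> \<le> 1 / 2" for \<delta>
    proof -
      define e where "e = p * \<delta>"
      have pos: "0 < mass p \<delta> i" "0 < mass p \<delta> j"
        using mass_pos[OF p \<delta>] ij by auto
      consider "i = 2" "j = 3" | "i = 2" "j = 4" | "i = 3" "j = 4"
        using False ij by (auto simp: le_Suc_eq less_Suc_eq numeral_eq_Suc)
      then have key: "25 / 2 * (mass p \<delta> j + mass p \<delta> i) \<le> mass p \<delta> i * (offset i - offset j)\<^sup>2"
        using p d[OF \<delta>, folded e_def]
        by cases (simp_all add: offset_simps mass_simps right_diff_distrib distrib_left flip: e_def)
      have "j = 3 \<or> j = 4"
        using False ij by auto
      then have eq: "mass p \<delta> j = p * (1 + \<delta>)"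
        by (auto simp: mass_simps)
      show ?thesis
        using merging_cost_ge(2)[OF pos(2,1) key] unfolding eq .
    qed
    then show ?thesis by blast
  qed
  then show ?thesis
  proof (elim disjE)
    assume *: "\<forall>\<delta>. \<bar>\<delta>\<bar> \<le> 1 / 2 \<longrightarrow> ?L \<delta>"
    show ?thesis
      using order_trans[OF mult_right_mono[OF *[rule_format] zero_le_power2] D] by blast
  next
    assume *: "\<forall>\<delta>. \<bar>\<delta>\<bar> \<le> 1 / 2 \<longrightarrow> ?R \<delta>"
    show ?thesis
      using order_trans[OF mult_right_mono[OF *[rule_format] zero_le_power2] D] by blast
  qed
qed

text \<open>The lighter pair is replaced by its midpoint, which is its centroid as both masses
  agree; the other three atoms are code points.\<close>

definition hard_quantizer :: "real \<Rightarrow> real \<Rightarrow> real set" where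
  "hard_quantizer c \<delta> = (*) c ` (if 0 \<le> \<delta> then {-13/2, 0, 4, 9} else {-9, -4, 0, 13/2})"

lemma hard_quantizer_distortion_le:
  assumes p: "0 < p" "p \<le> 1 / 10" "\<bar>\<delta>\<bar> \<le> 1 / 2"
  shows "distortion (hard_quantizer c \<delta>) (hard_measure p c \<delta>) \<le> 25 / 2 * (p * (1 - \<bar>\<delta>\<bar>)) * c\<^sup>2"
proof -
  define f :: "nat \<Rightarrow> real" where
    "f i = c * ((if 0 \<le> \<delta> then [-13/2, -13/2, 0, 4, 9] else [-9, -4, 0, 13/2, 13/2]) ! i)" for i
  have "distortion (hard_quantizer c \<delta>) (hard_measure p c \<delta>)
      \<le> (\<Sum>i<5. mass p \<delta> i * (c * offset i - f i) ^ 2)"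
    unfolding hard_measure_def
  proof (rule distortion_atomic_measure_le)
    have "\<forall>i<5. f i \<in> hard_quantizer c \<delta>"
      unfolding all_less_5 by (auto simp: f_def hard_quantizer_def)
    then show "f i \<in> hard_quantizer c \<delta>" if "i < 5" for i
      using that by blast
  qed (use mass_pos[OF p] in \<open>auto simp: hard_quantizer_def less_imp_le\<close>)
  \<comment> \<open>Only the merged pair contributes: two atoms of mass
    \<open>p * (1 - \<bar>\<delta>\<bar>)\<close> at distance \<open>5 / 2 * c\<close> from their
    code point.\<close>
  also have "\<dots> = 25 / 2 * (p * (1 - \<bar>\<delta>\<bar>)) * c\<^sup>2"
    by (cases "0 \<le> \<delta>") (simp_all add: sum_less_5 f_def offset_simps mass_simps power2_eq_square)
  finally show ?thesis .
qed

text \<open>Either alternative of \<open>hard_measure_distortion_ge\<close> is at least the cost of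
  merging the lighter pair, which \<open>hard_quantizer\<close> attains. The second claim fixes the
  distortion of every optimal quantizer, not only of this one.\<close>

lemma
  assumes p: "0 < p" "p \<le> 1 / 10" "\<bar>\<delta>\<bar> \<le> 1 / 2" and c: "0 < c"
  shows optimal_hard_quantizer: "optimal_quantizer 4 (hard_measure p c \<delta>) (hard_quantizer c \<delta>)"
    and optimal_quantizer_hard_measure: "optimal_quantizer 4 (hard_measure p c \<delta>) A \<Longrightarrow>
      distortion A (hard_measure p c \<delta>) = 25 / 2 * (p * (1 - \<bar>\<delta>\<bar>)) * c\<^sup>2"
proof -
  have lower: "25 / 2 * (p * (1 - \<bar>\<delta>\<bar>)) * c\<^sup>2 \<le> distortion B (hard_measure p c \<delta>)"
    if "finite B" "card B = 4" for B
  proof -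
    have "B \<noteq> {}" "card B \<le> 4"
      using that by auto
    moreover have "25 / 2 * (p * (1 - \<bar>\<delta>\<bar>)) * c\<^sup>2 \<le> 25 / 2 * (p * (1 - \<delta>)) * c\<^sup>2"
      "25 / 2 * (p * (1 - \<bar>\<delta>\<bar>)) * c\<^sup>2 \<le> 25 / 2 * (p * (1 + \<delta>)) * c\<^sup>2"
      using p by (auto intro!: mult_right_mono mult_left_mono)
    ultimately show ?thesis
      using hard_measure_distortion_ge[OF p(1,2) that(1), of c] p(3) by fastforce
  qed
  have fin: "finite (hard_quantizer c \<delta>)" "card (hard_quantizer c \<delta>) = 4"
    using c by (auto simp: hard_quantizer_def card_image inj_on_def)
  show "optimal_quantizer 4 (hard_measure p c \<delta>) (hard_quantizer c \<delta>)"
    unfolding optimal_quantizer_def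
    using fin lower hard_quantizer_distortion_le[OF p] by (meson order_trans)
  show "distortion A (hard_measure p c \<delta>) = 25 / 2 * (p * (1 - \<bar>\<delta>\<bar>)) * c\<^sup>2"
    if "optimal_quantizer 4 (hard_measure p c \<delta>) A"
    using that fin lower[of A] hard_quantizer_distortion_le[OF p, of c]
    unfolding optimal_quantizer_def by (meson order.antisym order_trans)
qed

text \<open>Light atoms may weigh less than \<open>p\<close>, but they share a cell of mass
  \<open>2 * p * (1 - \<bar>\<delta>\<bar>) \<ge> p\<close>. Heavy atoms have mass
  \<open>p * (1 + \<bar>\<delta>\<bar>)\<close> each, and the origin has
  \<open>1 - 4 * p\<close>.\<close>

lemma hard_quantizer_cells:
  assumes p: "0 < p" "p \<le> 1 / 10" "\<bar>\<delta>\<bar> \<le> 1 / 2" and c: "0 < c" and a: "a \<in> hard_quantizer c \<delta>"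
  shows "p \<le> measure (hard_measure p c \<delta>) (voronoi_cell (hard_quantizer c \<delta>) a)"
proof -
  define A where "A = (if 0 \<le> \<delta> then {-13/2, 0, 4, 9} else {-9, -4, 0, 13/2 :: real})"
  have A: "hard_quantizer c \<delta> = (*) c ` A"
    by (simp add: A_def hard_quantizer_def)
  then obtain b where b: "b \<in> A" "a = c * b"
    using a by blast
  have "p \<le> (\<Sum>i<5. mass p \<delta> i * indicator (voronoi_cell A b) (offset i))"
  proof (cases "0 \<le> \<delta>")
    case True
    define e where "e = p * \<delta>"
    have e: "0 \<le> e" "e \<le> p / 2"
      using True p mult_left_mono[of \<delta> "1 / 2" p] by (auto simp: e_def)
    have A': "A = {-13/2, 0, 4, 9}"
      using True by (simp add: A_def)
    with b(1) consider "b = -13/2" | "b = 0" | "b = 4" | "b = 9" by auto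
    then show ?thesis
      using e p(1,2) by cases (simp_all add: A' sum_less_5 mass_simps offset_simps voronoi_cell_def
          right_diff_distrib distrib_left flip: e_def)
  next
    case False
    define e where "e = p * \<delta>"
    have e: "e \<le> 0" "- (p / 2) \<le> e"
      using False p mult_left_mono[of "-1 / 2" \<delta> p] by (auto simp: e_def mult_le_0_iff)
    have A': "A = {-9, -4, 0, 13/2}"
      using False by (simp add: A_def)
    with b(1) consider "b = -9" | "b = -4" | "b = 0" | "b = 13/2" by auto
    then show ?thesis
      using e p(1,2) by cases (simp_all add: A' sum_less_5 mass_simps offset_simps voronoi_cell_def
          right_diff_distrib distrib_left flip: e_def)
  qed
  also have "\<dots> = (\<Sum>i<5. mass p \<delta> i *
      indicator (voronoi_cell (hard_quantizer c \<delta>) a) (c * offset i))"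
    unfolding A b(2) indicator_def voronoi_cell_scale[OF c] ..
  also have "\<dots> = measure (hard_measure p c \<delta>) (voronoi_cell (hard_quantizer c \<delta>) a)"
    unfolding hard_measure_def
    using mass_pos[OF p] sum_mass
    by (intro measure_atomic_measure[symmetric] borel_voronoi_cell)
      (auto simp: hard_quantizer_def less_imp_le)
  finally show ?thesis .
qed

lemma hard_measure_in_class:
  assumes p: "0 < p" "p \<le> 1 / 10" "\<bar>\<delta>\<bar> \<le> 1 / 2" and c: "0 < c" "194 * (p * c\<^sup>2) \<le> \<sigma>\<^sup>2"
  shows "hard_measure p c \<delta> \<in> quantizer_class 4 p \<sigma>"
proof -
  have m: "0 \<le> mass p \<delta> i" if "i < 5" for i
    using mass_pos[OF p] that by (auto intro: less_imp_le)
  have "(LINT x|hard_measure p c \<delta>. x\<^sup>2) = (\<Sum>i<5. mass p \<delta> i * (c * offset i)\<^sup>2)"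
    unfolding hard_measure_def using m by (intro integral_atomic_measure) auto
  \<comment> \<open>Here 194 is \<open>2 * (4^2 + 9^2)\<close>; the tilts of the two sides
    cancel.\<close>
  also have "\<dots> = 194 * (p * c\<^sup>2)"
    by (simp add: sum_less_5 mass_simps offset_simps power_mult_distrib algebra_simps)
  finally have "(LINT x|hard_measure p c \<delta>. x\<^sup>2) \<le> \<sigma>\<^sup>2"
    using c by simp
  moreover have "hard_quantizer c \<delta> \<noteq> {}" "finite (hard_quantizer c \<delta>)"
    by (auto simp: hard_quantizer_def)
  then have "p \<le> Min ((\<lambda>a. measure (hard_measure p c \<delta>) (voronoi_cell (hard_quantizer c \<delta>) a))
      ` hard_quantizer c \<delta>)"
    using hard_quantizer_cells[OF p c(1)] by (subst Min_ge_iff) auto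
  moreover have "real_distribution (hard_measure p c \<delta>)"
    unfolding hard_measure_def using m sum_mass by (intro real_distribution_atomic_measure) auto
  moreover have "integrable (hard_measure p c \<delta>) (\<lambda>x. x\<^sup>2)"
    unfolding hard_measure_def by (intro integrable_atomic_measure) auto
  ultimately show ?thesis
    using optimal_hard_quantizer[OF p c(1)] by (auto simp: quantizer_class_def)
qed

section \<open>Indistinguishability of opposite tilts\<close>

lemma hard_measure_density:
  assumes p: "0 < p" "p \<le> 1 / 10" "\<bar>\<delta>\<bar> \<le> 1 / 2" and c: "0 < c"
  shows "hard_measure p c \<delta> = density (hard_measure p c 0) (\<lambda>y. ennreal (1 + \<delta> * sgn y))"
proof -
  have "0 \<le> 1 + \<delta> * sgn y" for y :: real
    using p(3) by (auto simp: sgn_real_def)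
  moreover have "mass p \<delta> = (\<lambda>i. mass p 0 i * (1 + \<delta> * sgn (c * offset i)))"
    using c by (simp add: fun_eq_iff mass_def sgn_mult)
  ultimately show ?thesis
    unfolding hard_measure_def using mass_pos[OF p(1,2), of 0]
    by (subst density_atomic_measure) (auto simp: less_imp_le)
qed

lemma hard_measure_testing:
  assumes p: "0 < p" "p \<le> 1 / 10" "\<bar>\<delta>\<bar> \<le> 1 / 2" and c: "0 < c"
    and N: "real N * (4 * p * \<delta>\<^sup>2) \<le> 1 / 10"
    and B: "B \<in> sets (PiM {..<N} (\<lambda>_. borel))"
  shows "1 / 2 \<le> measure (PiM {..<N} (\<lambda>_. hard_measure p c \<delta>)) B
    + measure (PiM {..<N} (\<lambda>_. hard_measure p c (-\<delta>)))
        (space (PiM {..<N} (\<lambda>_. hard_measure p c 0)) - B)"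
proof -
  let ?M = "hard_measure p c 0"
  let ?e = "4 * p * \<delta>\<^sup>2"
  have m: "0 \<le> mass p 0 i" if "i < 5" for i
    using mass_pos[OF p(1,2), of 0] that by (auto intro: less_imp_le)
  have int: "(LINT y|?M. f y) = (\<Sum>i<5. mass p 0 i * f (c * offset i))" "integrable ?M f"
    if "f \<in> borel_measurable borel" for f :: "real \<Rightarrow> real"
    unfolding hard_measure_def
    using integral_atomic_measure[OF m that] integrable_atomic_measure[OF that] by auto
  have nn: "0 \<le> 1 + d * sgn y" if "\<bar>d\<bar> \<le> 1 / 2" for d y :: real
    using that by (auto simp: sgn_real_def)
  have sgn: "sgn (c * x) = sgn x" for x
    using c by (simp add: sgn_mult)
  \<comment> \<open>Under the untilted law \<open>sgn\<close> has mean 0 by symmetry and its square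
    has mean \<open>4 * p\<close>, the total outer mass.\<close>
  have eq: "(LINT y|?M. 1 + \<delta> * sgn y) = 1" "(LINT y|?M. 1 + - \<delta> * sgn y) = 1"
    "(LINT y|?M. (1 + \<delta> * sgn y)\<^sup>2) = 1 + ?e" "(LINT y|?M. (1 + - \<delta> * sgn y)\<^sup>2) = 1 + ?e"
    "(LINT y|?M. (1 + \<delta> * sgn y) * (1 + - \<delta> * sgn y)) = 1 - ?e"
    by (subst int(1), measurable,
        simp add: sgn sum_less_5 mass_simps offset_simps power2_eq_square algebra_simps)+
  have N': "real N * ?e \<le> 1 / 10"
    using N by simp
  have e: "0 \<le> ?e" "?e \<le> 1"
  proof -
    have "\<delta>\<^sup>2 \<le> 1"
      using p(3) by (simp add: abs_square_le_1)
    then show "0 \<le> ?e" "?e \<le> 1"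
      using mult_mono[of "4 * p" "1" "\<delta>\<^sup>2" 1] p(1,2) by auto
  qed
  \<comment> \<open>The squared \<open>L\<^sup>2\<close> distance is
    \<open>2 * (1 + ?e) ^ N - 2 * (1 - ?e) ^ N\<close>. The two bounds proved next make it at most
    \<open>2 * 1.11 - 2 * 0.9 = 0.42\<close>.\<close>
  have "(1 + ?e) ^ N \<le> exp ?e ^ N"
    using e by (intro power_mono) auto
  also have "\<dots> = exp (real N * ?e)"
    by (rule exp_of_nat_mult[symmetric])
  also have "\<dots> \<le> 1 + real N * ?e + (real N * ?e)\<^sup>2"
    using e(1) N' p(1) by (intro exp_bound mult_nonneg_nonneg) auto
  also have "\<dots> \<le> 1 + 1 / 10 + (1 / 10)\<^sup>2"
    using e(1) N' p(1) by (intro add_mono power_mono) auto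
  finally have up: "(1 + ?e) ^ N \<le> 1 + 1 / 10 + (1 / 10)\<^sup>2" .
  have low: "1 - real N * ?e \<le> (1 - ?e) ^ N"
    using Bernoulli_inequality[of "- ?e" N] e by simp
  have sp: "space (PiM {..<N} (\<lambda>_. ?M)) = space (PiM {..<N} (\<lambda>_. borel))"
    "sets (PiM {..<N} (\<lambda>_. ?M)) = sets (PiM {..<N} (\<lambda>_. borel))"
    by (simp_all add: hard_measure_def space_PiM cong: sets_PiM_cong)
  have "prob_space ?M"
    using real_distribution_atomic_measure[OF m sum_mass]
    by (simp add: hard_measure_def real_distribution_def)
  then have "1 / 2 \<le> measure (PiM {..<N} (\<lambda>_. density ?M (\<lambda>y. ennreal (1 + \<delta> * sgn y)))) B
    + measure (PiM {..<N} (\<lambda>_. density ?M (\<lambda>y. ennreal (1 + - \<delta> * sgn y))))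
        (space (PiM {..<N} (\<lambda>_. ?M)) - B)"
  proof (rule prob_space_product_testing[OF finite_lessThan])
    show "(LINT y|?M. (1 + \<delta> * sgn y)\<^sup>2) ^ card {..<N} + (LINT y|?M. (1 + - \<delta> * sgn y)\<^sup>2) ^ card {..<N}
        - 2 * (LINT y|?M. (1 + \<delta> * sgn y) * (1 + - \<delta> * sgn y)) ^ card {..<N} \<le> 1"
      unfolding eq using up low N' by (simp add: power2_eq_square)
    show "(\<lambda>y. 1 + \<delta> * sgn y) \<in> borel_measurable ?M" "(\<lambda>y. 1 + - \<delta> * sgn y) \<in> borel_measurable ?M"
      unfolding hard_measure_def by measurable
  qed (use eq nn[of \<delta>] nn[of "-\<delta>"] p B sp in \<open>auto intro!: int\<close>)
  then show ?thesis
    using hard_measure_density[OF p c] hard_measure_density[OF p(1,2) _ c, of "-\<delta>"] p(3) sp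
    by simp
qed

section \<open>The lower bound for empirical design\<close>

theorem theorem3p10:
  fixes \<sigma> p_min :: real and N :: nat and Q :: "(nat \<Rightarrow> real) \<Rightarrow> real set"
  assumes "\<sigma> > 0" and "0 < p_min" and "p_min \<le> 1 / 10"
    and "N \<ge> 1" and "real N * p_min > 1 / 8"
    and "empirical_quantizer 4 N Q"
  shows "\<exists>P \<in> quantizer_class 4 p_min \<sigma>.
           \<forall>A. optimal_quantizer 4 P A \<longrightarrow>
             \<P>(x in Pi\<^sub>M {..<N} (\<lambda>_. P).
                  distortion (Q x) P - distortion A P
                    \<ge> \<sigma> ^ 2 / 60 * sqrt (1 / (real N * p_min))) \<ge> 1 / 4"
proof -
  define p where "p = p_min"
  \<comment> \<open>This makes the second moment
    \<open>194 / 200 * \<sigma>\<^sup>2\<close>.\<close>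
  define c where "c = \<sigma> / sqrt (200 * p)"
  \<comment> \<open>The loss \<open>25 * p * \<delta> * c\<^sup>2\<close> is
    \<open>\<delta> * \<sigma>\<^sup>2 / 8\<close>, so \<open>2 / 15\<close> yields the constant
    \<open>1 / 60\<close>. Moreover \<open>4 * N * p * \<delta>\<^sup>2 = 16 / 225\<close> is below
    \<open>1 / 10\<close>, and \<open>N * p > 1 / 8\<close> gives
    \<open>\<delta>\<^sup>2 < 32 / 225\<close>.\<close>
  define \<delta> where "\<delta> = 2 / 15 * sqrt (1 / (real N * p))"
  define gap where "gap = \<sigma> ^ 2 / 60 * sqrt (1 / (real N * p))"
  have p: "0 < p" "p \<le> 1 / 10" and Np: "1 / 8 < real N * p"
    using assms by (auto simp: p_def)
  have c: "0 < c" "p * c\<^sup>2 = \<sigma>\<^sup>2 / 200"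
    using p assms(1) by (auto simp: c_def power_divide)
  have \<delta>2: "\<delta>\<^sup>2 = 4 / 225 / (real N * p)"
    using Np by (simp add: \<delta>_def power_mult_distrib power_divide)
  have \<delta>0: "0 \<le> \<delta>"
    using Np by (simp add: \<delta>_def)
  have "\<delta>\<^sup>2 \<le> (1 / 2)\<^sup>2"
    unfolding \<delta>2 using Np by (simp add: divide_simps)
  then have \<delta>: "\<delta> \<le> 1 / 2"
    by (rule power2_le_imp_le) simp
  have N: "real N * (4 * p * \<delta>\<^sup>2) \<le> 1 / 10"
    unfolding \<delta>2 using Np by (simp add: divide_simps)
  have gap: "gap = 25 * p * \<delta> * c\<^sup>2"
  proof -
    have "25 * p * \<delta> * c\<^sup>2 = 25 * \<delta> * (p * c\<^sup>2)" by simp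
    then show ?thesis
      by (simp add: c(2) gap_def \<delta>_def)
  qed
  let ?P = "hard_measure p c"
  let ?S = "PiM {..<N} (\<lambda>_. borel :: real measure)"
  \<comment> \<open>The optimal distortion depends only on the absolute value of the tilt, so one
    \<open>D\<close> serves both; \<open>gap\<close> is the extra cost of merging the heavier
    pair.\<close>
  define D where "D = 25 / 2 * (p * (1 - \<delta>)) * c\<^sup>2"
  define E where "E d = {x \<in> space ?S. gap \<le> distortion (Q x) (?P d) - D}" for d
  have sp: "space (PiM {..<N} (\<lambda>_. ?P d)) = space ?S" for d
    by (simp add: hard_measure_def space_PiM)
  have sets: "sets (PiM {..<N} (\<lambda>_. ?P d)) = sets ?S" for d
    by (simp add: hard_measure_def cong: sets_PiM_cong)
  have meas: "E d \<in> sets ?S" if "\<bar>d\<bar> \<le> 1 / 2" for d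
  proof -
    have [measurable]: "(\<lambda>x. distortion (Q x) (?P d)) \<in> borel_measurable ?S"
      unfolding hard_measure_def using mass_pos[OF p that]
      by (intro borel_measurable_distortion_empirical[OF assms(6)]) (auto intro: less_imp_le)
    show ?thesis
      unfolding E_def by measurable
  qed
  have abs_le: "\<bar>\<delta>\<bar> \<le> 1 / 2" "\<bar>-\<delta>\<bar> \<le> 1 / 2"
    using \<delta> \<delta>0 by auto
  have Dgap: "D + gap = 25 / 2 * (p * (1 + \<delta>)) * c\<^sup>2" "D + gap = 25 / 2 * (p * (1 - - \<delta>)) * c\<^sup>2"
    by (simp_all add: D_def gap field_simps)
  \<comment> \<open>The first alternative of \<open>hard_measure_distortion_ge\<close> is read at
    tilt \<open>-\<delta>\<close>, the second at \<open>\<delta>\<close>: the side found is then the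
    heavy one.\<close>
  have cover: "space ?S - E \<delta> \<subseteq> E (-\<delta>)"
  proof
    fix x assume x: "x \<in> space ?S - E \<delta>"
    then have "finite (Q x)" "Q x \<noteq> {}" "card (Q x) \<le> 4"
      using assms(6) by (auto simp: empirical_quantizer_def)
    then have "D + gap \<le> distortion (Q x) (?P (-\<delta>)) \<or> D + gap \<le> distortion (Q x) (?P \<delta>)"
      using hard_measure_distortion_ge[OF p, of "Q x" c] abs_le Dgap by metis
    then show "x \<in> E (-\<delta>)"
      using x by (auto simp: E_def)
  qed
  have "1 / 2 \<le> measure (PiM {..<N} (\<lambda>_. ?P \<delta>)) (E \<delta>)
      + measure (PiM {..<N} (\<lambda>_. ?P (-\<delta>))) (space ?S - E \<delta>)"
    using hard_measure_testing[OF p _ c(1) N meas] \<delta> \<delta>0 by (simp add: sp)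
  moreover have "measure (PiM {..<N} (\<lambda>_. ?P (-\<delta>))) (space ?S - E \<delta>)
      \<le> measure (PiM {..<N} (\<lambda>_. ?P (-\<delta>))) (E (-\<delta>))"
  proof -
    have "mass p (-\<delta>) i \<ge> 0" if "i < 5" for i
      using mass_pos[OF p, of "-\<delta>"] \<delta> \<delta>0 that by (auto intro: less_imp_le)
    then interpret P: real_distribution "?P (-\<delta>)"
      unfolding hard_measure_def using sum_mass by (intro real_distribution_atomic_measure) auto
    interpret PP: product_prob_space "\<lambda>_. ?P (-\<delta>)" "{..<N}" ..
    show ?thesis
      using cover meas[of "-\<delta>"] \<delta> \<delta>0 by (intro PP.finite_measure_mono) (auto simp: sets)
  qed
  \<comment> \<open>Two probabilities with sum at least \<open>1 / 2\<close> cannot both be below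
    \<open>1 / 4\<close>. The tilt \<open>d\<close> is thus chosen from \<open>Q\<close> as a whole,
    not from a sample.\<close>
  ultimately have "1 / 4 \<le> measure (PiM {..<N} (\<lambda>_. ?P \<delta>)) (E \<delta>) \<or>
      1 / 4 \<le> measure (PiM {..<N} (\<lambda>_. ?P (-\<delta>))) (E (-\<delta>))"
    by linarith
  then obtain d where d: "d = \<delta> \<or> d = -\<delta>"
    "1 / 4 \<le> measure (PiM {..<N} (\<lambda>_. ?P d)) (E d)"
    by blast
  then have abs: "\<bar>d\<bar> = \<delta>" "\<bar>d\<bar> \<le> 1 / 2"
    using \<delta> \<delta>0 by auto
  have "194 * (p * c\<^sup>2) \<le> \<sigma>\<^sup>2"
    unfolding c(2) by simp
  then have "?P d \<in> quantizer_class 4 p_min \<sigma>"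
    using hard_measure_in_class[OF p abs(2) c(1)] by (simp add: p_def)
  moreover have "1 / 4 \<le> \<P>(x in PiM {..<N} (\<lambda>_. ?P d).
      distortion (Q x) (?P d) - distortion A (?P d) \<ge> \<sigma> ^ 2 / 60 * sqrt (1 / (real N * p_min)))"
    if "optimal_quantizer 4 (?P d) A" for A
  proof -
    have "distortion A (?P d) = D"
      using optimal_quantizer_hard_measure[OF p abs(2) c(1) that] by (simp add: abs(1) D_def)
    then show ?thesis
      using d(2) by (simp only: sp E_def gap_def p_def[symmetric])
  qed
  ultimately show ?thesis by blast
qed

end
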